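(* Let $g \in \mathrm{Aut}(\mathbb{S}) \setminus \{\mathrm{id}\}$, where $\mathbb{S}$ is the semigeneric tournament, and let $\mathrm{supp}(g)=\{v\in\mathbb{S}\mid g(v)\neq v\}$. Then $\mathrm{supp}(g) \cap P$ is infinite for each part $P$ of $\mathbb{S}$.
   Context: An oriented graph is a set with an irreflexive antisymmetric relation $\to$. Write $u\perp v$ if there is no edge between $u$ and $v$ in either direction (so $u\perp u$). An oriented graph is an $\omega$-partite tournament if $\perp$ is an equivalence relation on it; the equivalence classes are called parts. Let $\mathcal{S}$ be the class of finite $\omega$-partite tournaments satisfying the parity condition: for any two pairs $\{u,u'\}$ and $\{v,v'\}$ of vertices with $u\perp u'$, $v\perp v'$ (two distinct vertices in each pair) lying in two different parts, the number of edges directed from a vertex of $\{u,u'\}$ to a vertex of $\{v,v'\}$ is even. $\mathcal{S}$ is a Fraïssé class, and the semigeneric tournament $\mathbb{S}$ is its Fraïssé limit: the unique up to isomorphism countable ultrahomogeneous oriented graph whose finite substructures are, up to isomorphism, exactly the members of $\mathcal{S}$. *)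

theory Defs
  imports "HOL-Library.Countable_Set" "HOL-Combinatorics.Permutations"
begin

text \<open>
  A structure is a carrier \<open>V\<close> together with an edge relation \<open>E\<close>, of which only the restriction
  to \<open>V\<close> is ever used. Substructures are thus given by subsets of \<open>V\<close> with the same \<open>E\<close>.
\<close>

definition oriented_graph :: "'a set \<Rightarrow> ('a \<Rightarrow> 'a \<Rightarrow> bool) \<Rightarrow> bool" where
  "oriented_graph V E \<longleftrightarrow> irreflp_on V E \<and> antisymp_on V E"

definition perp :: "'a set \<Rightarrow> ('a \<Rightarrow> 'a \<Rightarrow> bool) \<Rightarrow> 'a rel" where
  "perp V E = {(u, v) \<in> V \<times> V. \<not> E u v \<and> \<not> E v u}"

definition partite_tournament :: "'a set \<Rightarrow> ('a \<Rightarrow> 'a \<Rightarrow> bool) \<Rightarrow> bool" where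
  "partite_tournament V E \<longleftrightarrow> oriented_graph V E \<and> equiv V (perp V E)"

definition parts :: "'a set \<Rightarrow> ('a \<Rightarrow> 'a \<Rightarrow> bool) \<Rightarrow> 'a set set" where
  "parts V E = V // perp V E"

definition parity_condition :: "'a set \<Rightarrow> ('a \<Rightarrow> 'a \<Rightarrow> bool) \<Rightarrow> bool" where
  "parity_condition V E \<longleftrightarrow>
     (\<forall>P \<in> parts V E. \<forall>Q \<in> parts V E. P \<noteq> Q \<longrightarrow>
       (\<forall>u \<in> P. \<forall>u' \<in> P. \<forall>v \<in> Q. \<forall>v' \<in> Q. u \<noteq> u' \<longrightarrow> v \<noteq> v' \<longrightarrow>
          even (card {(x, y) \<in> {u, u'} \<times> {v, v'}. E x y})))"

definition class_S :: "'a set \<Rightarrow> ('a \<Rightarrow> 'a \<Rightarrow> bool) \<Rightarrow> bool" where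
  "class_S V E \<longleftrightarrow> finite V \<and> partite_tournament V E \<and> parity_condition V E"

definition graph_iso ::
  "('a \<Rightarrow> 'b) \<Rightarrow> 'a set \<Rightarrow> ('a \<Rightarrow> 'a \<Rightarrow> bool) \<Rightarrow> 'b set \<Rightarrow> ('b \<Rightarrow> 'b \<Rightarrow> bool) \<Rightarrow> bool" where
  "graph_iso f V E W F \<longleftrightarrow>
     bij_betw f V W \<and> (\<forall>u \<in> V. \<forall>v \<in> V. E u v \<longleftrightarrow> F (f u) (f v))"

text \<open>
  Automorphisms are total functions on the ambient type that are the identity outside \<open>V\<close>, so that
  the identity automorphism is \<^const>\<open>id\<close>.
\<close>

definition Aut :: "'a set \<Rightarrow> ('a \<Rightarrow> 'a \<Rightarrow> bool) \<Rightarrow> ('a \<Rightarrow> 'a) set" where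
  "Aut V E = {g. g permutes V \<and> graph_iso g V E V E}"

definition ultrahomogeneous :: "'a set \<Rightarrow> ('a \<Rightarrow> 'a \<Rightarrow> bool) \<Rightarrow> bool" where
  "ultrahomogeneous V E \<longleftrightarrow>
     (\<forall>A B f. A \<subseteq> V \<longrightarrow> B \<subseteq> V \<longrightarrow> finite A \<longrightarrow> finite B \<longrightarrow> graph_iso f A E B E \<longrightarrow>
        (\<exists>g \<in> Aut V E. \<forall>a \<in> A. g a = f a))"

text \<open>
  The last two conjuncts say that the finite substructures are, up to isomorphism, exactly the
  members of the class. Every finite structure has an isomorphic copy with vertices in
  \<^typ>\<open>nat\<close>, so it is enough to embed the members of the class on finite sets of naturals.
\<close>

definition semigeneric_tournament :: "'a set \<Rightarrow> ('a \<Rightarrow> 'a \<Rightarrow> bool) \<Rightarrow> bool" where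
  "semigeneric_tournament V E \<longleftrightarrow>
     countable V \<and> oriented_graph V E \<and> ultrahomogeneous V E \<and>
     (\<forall>A. A \<subseteq> V \<longrightarrow> finite A \<longrightarrow> class_S A E) \<and>
     (\<forall>(W :: nat set) F. class_S W F \<longrightarrow> (\<exists>A f. A \<subseteq> V \<and> graph_iso f W F A E))"

definition supp :: "'a set \<Rightarrow> ('a \<Rightarrow> 'a) \<Rightarrow> 'a set" where
  "supp V g = {v \<in> V. g v \<noteq> v}"

end

theory Submission
  imports Defs
begin

text \<open>
  Suppose that \<open>g\<close> moves only finitely many vertices of the part \<open>P\<close>. Given \<open>q\<close> outside \<open>P\<close> with
  \<open>q\<close> and \<open>g q\<close> in different parts, some fixed vertex \<open>v\<close> of \<open>P\<close> has an edge to \<open>q\<close> but none to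
  \<open>g q\<close>, which is impossible; hence \<open>g\<close> maps every part to itself. Let \<open>g q \<noteq> q\<close>, take \<open>s\<close> in the
  part of \<open>q\<close> outside \<open>{q, g q, g\<inverse> q}\<close>, and \<open>r\<close> in a different part whose only out-neighbour among
  \<open>q, s, g q, g s\<close> is \<open>q\<close>. Then \<open>r\<close> separates \<open>q\<close> from \<open>s\<close>, so \<open>g r\<close> separates \<open>g q\<close> from \<open>g s\<close>,
  and by parity so does \<open>r\<close>, which lies in the part of \<open>g r\<close>: a contradiction.
\<close>

section \<open>Perpendicularity, membership in the class, automorphisms\<close>

lemma perp_iff: "(u, v) \<in> perp V E \<longleftrightarrow> u \<in> V \<and> v \<in> V \<and> \<not> E u v \<and> \<not> E v u"
  by (auto simp: perp_def)

text \<open>Parity only constrains two parts with at least two vertices each. Here only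
  \<open>C\<close> can contribute such a part, so the condition is vacuous.\<close>

lemma class_S_if_one_nontrivial_part:
  assumes "finite W" and anti: "antisymp_on W E"
    and perp: "\<And>u v. u \<in> W \<Longrightarrow> v \<in> W \<Longrightarrow> \<not> E u v \<and> \<not> E v u \<longleftrightarrow> u = v \<or> u \<in> C \<and> v \<in> C"
  shows "class_S W E"
proof -
  have irrefl: "irreflp_on W E"
    using perp by (auto simp: irreflp_on_def)
  have equiv: "equiv W (perp W E)"
  proof (rule equivI)
    show "perp W E \<subseteq> W \<times> W" by (auto simp: perp_def)
    show "refl_on W (perp W E)"
      using perp by (auto simp: refl_on_def perp_iff)
    show "sym (perp W E)" by (auto simp: sym_def perp_iff)
    show "trans (perp W E)"
      unfolding trans_def perp_iff using perp by metis
  qed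
  have "parity_condition W E"
    unfolding parity_condition_def
  proof (intro ballI impI)
    fix P Q u u' v v'
    assume P: "P \<in> parts W E" and Q: "Q \<in> parts W E" and "P \<noteq> Q"
      and u: "u \<in> P" "u' \<in> P" and v: "v \<in> Q" "v' \<in> Q" and "u \<noteq> u'" "v \<noteq> v'"
    have "(u, u') \<in> perp W E" "(v, v') \<in> perp W E"
      using equiv P Q u v unfolding parts_def by (meson quotient_eq_iff)+
    then have "u \<in> W" "v \<in> W" "u \<in> C" "v \<in> C"
      using perp \<open>u \<noteq> u'\<close> \<open>v \<noteq> v'\<close> by (auto simp: perp_iff)
    then have "(u, v) \<in> perp W E" using perp by (auto simp: perp_iff)
    then have "P = Q"
      using quotient_eq_iff[OF equiv P[unfolded parts_def] Q[unfolded parts_def] u(1) v(1)] by simp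
    with \<open>P \<noteq> Q\<close> show "even (card {(x, y) \<in> {u, u'} \<times> {v, v'}. E x y})" by simp
  qed
  then show ?thesis
    using assms(1) anti irrefl equiv
    by (simp add: class_S_def partite_tournament_def oriented_graph_def)
qed

lemma Aut_edge_iff:
  "g \<in> Aut V E \<Longrightarrow> u \<in> V \<Longrightarrow> v \<in> V \<Longrightarrow> E (g u) (g v) \<longleftrightarrow> E u v"
  by (simp add: Aut_def graph_iso_def)

lemma Aut_mem_iff: "g \<in> Aut V E \<Longrightarrow> g v \<in> V \<longleftrightarrow> v \<in> V"
  by (simp add: Aut_def permutes_in_image)

lemma Aut_perp_iff:
  "g \<in> Aut V E \<Longrightarrow> (g u, g v) \<in> perp V E \<longleftrightarrow> (u, v) \<in> perp V E"
  by (auto simp: perp_iff Aut_edge_iff Aut_mem_iff)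

section \<open>Parts, parity and one-point extensions of the semigeneric tournament\<close>

locale semigeneric =
  fixes V :: "'a set" and E :: "'a \<Rightarrow> 'a \<Rightarrow> bool"
  assumes semigeneric: "semigeneric_tournament V E"
begin

lemma finite_substructure: "A \<subseteq> V \<Longrightarrow> finite A \<Longrightarrow> class_S A E"
  using semigeneric by (simp add: semigeneric_tournament_def)

lemma irrefl: "v \<in> V \<Longrightarrow> \<not> E v v"
  using semigeneric
  by (auto simp: semigeneric_tournament_def oriented_graph_def irreflp_on_def)

lemma antisym: "u \<in> V \<Longrightarrow> v \<in> V \<Longrightarrow> E u v \<Longrightarrow> \<not> E v u"
  using semigeneric irrefl
  by (auto simp: semigeneric_tournament_def oriented_graph_def antisymp_on_def)

text \<open>Membership in the class is given only for finite substructures, but transitivity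
  concerns three vertices at a time.\<close>

lemma equiv_perp: "equiv V (perp V E)"
proof (rule equivI)
  show "perp V E \<subseteq> V \<times> V" by (auto simp: perp_def)
  show "refl_on V (perp V E)" by (auto simp: refl_on_def perp_iff irrefl)
  show "sym (perp V E)" by (auto simp: sym_def perp_iff)
  show "trans (perp V E)"
  proof (rule transI)
    fix x y z assume xyz: "(x, y) \<in> perp V E" "(y, z) \<in> perp V E"
    then have "class_S {x, y, z} E" by (intro finite_substructure) (auto simp: perp_iff)
    then have "trans (perp {x, y, z} E)"
      by (simp add: class_S_def partite_tournament_def equiv_def)
    moreover have "(x, y) \<in> perp {x, y, z} E" "(y, z) \<in> perp {x, y, z} E"
      using xyz by (auto simp: perp_iff)
    ultimately have "(x, z) \<in> perp {x, y, z} E" by (meson transD)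
    with xyz show "(x, z) \<in> perp V E" by (auto simp: perp_iff)
  qed
qed

lemma perp_refl: "v \<in> V \<Longrightarrow> (v, v) \<in> perp V E"
  and perp_sym: "(u, v) \<in> perp V E \<Longrightarrow> (v, u) \<in> perp V E"
  and perp_trans: "(u, v) \<in> perp V E \<Longrightarrow> (v, w) \<in> perp V E \<Longrightarrow> (u, w) \<in> perp V E"
  using equiv_perp by (auto simp: equiv_def refl_on_def dest: symD transD)

text \<open>Evenness in usable form: \<open>u\<close> separates \<open>v\<close> from
  \<open>v'\<close> exactly when \<open>u'\<close> does. It comes from the substructure on the four
  vertices; coinciding vertices make it trivial.\<close>

lemma parity:
  assumes uu': "(u, u') \<in> perp V E" and vv': "(v, v') \<in> perp V E" and uv: "(u, v) \<notin> perp V E"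
  shows "(E u v \<longleftrightarrow> E u v') \<longleftrightarrow> (E u' v \<longleftrightarrow> E u' v')"
proof (cases "u = u' \<or> v = v'")
  case False
  let ?A = "{u, u', v, v'}" and ?T = "{(x, y) \<in> {u, u'} \<times> {v, v'}. E x y}"
  have "class_S ?A E"
    using uu' vv' by (intro finite_substructure) (auto simp: perp_iff)
  then have par: "parity_condition ?A E"
    by (simp add: class_S_def)
  have mem: "u \<in> V" "u' \<in> V" "v \<in> V" "v' \<in> V"
    using uu' vv' by (auto simp: perp_iff)
  have "perp ?A E `` {u} \<in> parts ?A E" "perp ?A E `` {v} \<in> parts ?A E"
    by (auto simp: parts_def intro: quotientI)
  moreover have "v \<in> perp ?A E `` {v}" "v \<notin> perp ?A E `` {u}"
      "v' \<in> perp ?A E `` {v}" "u \<in> perp ?A E `` {u}" "u' \<in> perp ?A E `` {u}"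
    using uu' vv' uv mem irrefl by (auto simp: perp_iff)
  ultimately have "even (card ?T)"
    using par False unfolding parity_condition_def by blast
  moreover have "card ?T =
      of_bool (E u v) + of_bool (E u v') + of_bool (E u' v) + of_bool (E u' v')"
  proof -
    have "card ?T = card (({u, u'} \<times> {v, v'}) \<inter> {p. E (fst p) (snd p)})"
      by (rule arg_cong[where f = card]) auto
    also have "\<dots> = (\<Sum>p\<in>{u, u'} \<times> {v, v'}. of_bool (E (fst p) (snd p)))"
      by (simp add: sum_of_bool_eq)
    also have "\<dots> = (\<Sum>x\<in>{u, u'}. \<Sum>y\<in>{v, v'}. of_bool (E x y))"
      unfolding sum.cartesian_product by (intro sum.cong) auto
    finally show ?thesis using False by simp
  qed
  ultimately show ?thesis by (cases "E u v"; cases "E u v'"; cases "E u' v"; cases "E u' v'") auto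
qed auto

text \<open>
  With \<open>C\<close> as its only possibly nontrivial part, \<open>A\<close> together with \<open>x\<close> satisfies the parity condition
  vacuously, so the out-neighbours \<open>N\<close> of \<open>x\<close> can be prescribed freely.
\<close>

lemma extension:
  assumes A: "A \<subseteq> V" "finite A" and "C \<subseteq> A"
    and perp: "\<And>u v. u \<in> A \<Longrightarrow> v \<in> A \<Longrightarrow> (u, v) \<in> perp V E \<longleftrightarrow> u = v \<or> u \<in> C \<and> v \<in> C"
    and D: "D = C \<or> D = {}"
  obtains x where "x \<in> V - A" "\<And>a. a \<in> A \<Longrightarrow> (x, a) \<in> perp V E \<longleftrightarrow> a \<in> D"
    "\<And>a. a \<in> A - D \<Longrightarrow> E x a \<longleftrightarrow> a \<in> N"
proof -
  let ?X = "insert None (Some ` A)"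
  \<comment> \<open>\<open>None\<close> is the new vertex. For \<open>D = C\<close> it joins the
    part \<open>C\<close>; for \<open>D\<close> empty it forms a part alone.\<close>
  define C' where "C' = (if D = C then insert None (Some ` C) else Some ` C)"
  \<comment> \<open>Outside \<open>D\<close>, every old vertex is joined to \<open>None\<close>, in
    the direction that \<open>N\<close> dictates.\<close>
  define F where "F u v = (case u of
      None \<Rightarrow> (case v of None \<Rightarrow> False | Some b \<Rightarrow> b \<notin> D \<and> b \<in> N)
    | Some a \<Rightarrow> (case v of None \<Rightarrow> a \<notin> D \<and> a \<notin> N | Some b \<Rightarrow> E a b))" for u v
  have F_anti: "antisymp_on ?X F"
    using A antisym by (auto simp: antisymp_on_def F_def split: option.splits)
  have F_perp: "\<not> F u v \<and> \<not> F v u \<longleftrightarrow> u = v \<or> u \<in> C' \<and> v \<in> C'"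
    if "u \<in> ?X" "v \<in> ?X" for u v
    using that D perp A irrefl
    by (cases u; cases v) (auto simp: F_def C'_def perp_iff subset_iff)
  \<comment> \<open>Universality speaks of graphs on naturals, so \<open>F\<close> is transported
    along \<open>h\<close>.\<close>
  have "finite ?X" using A by simp
  then obtain h :: "'a option \<Rightarrow> nat" where h: "bij_betw h ?X {0..<card ?X}"
    using ex_bij_betw_finite_nat by blast
  let ?W = "{0..<card ?X}"
  let ?k = "inv_into ?X h"
  have k: "bij_betw ?k ?W ?X" by (rule bij_betw_inv_into[OF h])
  have "class_S ?W (\<lambda>i j. F (?k i) (?k j))"
  proof (rule class_S_if_one_nontrivial_part[where C = "{i. ?k i \<in> C'}"])
    have k_in: "?k i \<in> ?X" if "i \<in> ?W" for i using k that by (meson bij_betwE)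
    have k_inj: "?k i = ?k j \<longleftrightarrow> i = j" if "i \<in> ?W" "j \<in> ?W" for i j
      using k that by (meson bij_betw_def inj_on_eq_iff)
    show "antisymp_on ?W (\<lambda>i j. F (?k i) (?k j))"
    proof (rule antisymp_onI)
      fix i j assume ij: "i \<in> ?W" "j \<in> ?W" "F (?k i) (?k j)" "F (?k j) (?k i)"
      then have "?k i = ?k j" using antisymp_onD[OF F_anti k_in k_in] by blast
      then show "i = j" using k_inj ij by blast
    qed
    show "\<not> F (?k u) (?k v) \<and> \<not> F (?k v) (?k u) \<longleftrightarrow> u = v \<or> u \<in> {i. ?k i \<in> C'} \<and> v \<in> {i. ?k i \<in> C'}"
      if "u \<in> ?W" "v \<in> ?W" for u v
      using F_perp[OF k_in[OF that(1)] k_in[OF that(2)]] k_inj[OF that] by auto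
  qed simp
  then obtain B f where "B \<subseteq> V" and f: "graph_iso f ?W (\<lambda>i j. F (?k i) (?k j)) B E"
    using semigeneric unfolding semigeneric_tournament_def by blast
  define m where "m = f \<circ> h"
  have m: "bij_betw m ?X B"
    using f h unfolding m_def graph_iso_def by (blast intro: bij_betw_trans)
  have mE: "E (m u) (m v) \<longleftrightarrow> F u v" if "u \<in> ?X" "v \<in> ?X" for u v
  proof -
    have "h u \<in> ?W" "h v \<in> ?W" using h that by (meson bij_betwE)+
    moreover have "?k (h u) = u" "?k (h v) = v"
      using h that by (meson bij_betw_inv_into_left)+
    ultimately show ?thesis using f unfolding m_def graph_iso_def by (metis comp_apply)
  qed
  \<comment> \<open>The embedded copy of \<open>A\<close> need not be \<open>A\<close> itself.
    Ultrahomogeneity extends the inverse of \<open>e\<close> to an automorphism \<open>g\<close>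
    carrying the copy back to \<open>A\<close>; it takes the image of \<open>None\<close> to the
    wanted vertex.\<close>
  define e where "e a = m (Some a)" for a
  have e_inj: "inj_on e A"
    using m by (auto simp: e_def bij_betw_def inj_on_def)
  have iso: "graph_iso (inv_into A e) (e ` A) E A E"
    unfolding graph_iso_def
  proof (intro conjI ballI)
    show "bij_betw (inv_into A e) (e ` A) A"
      using e_inj by (simp add: bij_betw_inv_into inj_on_imp_bij_betw)
    fix u v assume "u \<in> e ` A" "v \<in> e ` A"
    then show "E u v \<longleftrightarrow> E (inv_into A e u) (inv_into A e v)"
      using mE by (auto simp: inv_into_f_f[OF e_inj]) (auto simp: e_def F_def)
  qed
  have "e ` A \<subseteq> V"
    using m \<open>B \<subseteq> V\<close> by (auto simp: e_def bij_betw_def)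
  moreover have "ultrahomogeneous V E"
    using semigeneric by (simp add: semigeneric_tournament_def)
  ultimately obtain g where g: "g \<in> Aut V E" "\<forall>b\<in>e ` A. g b = inv_into A e b"
    using A finite_imageI[OF A(2)] iso unfolding ultrahomogeneous_def by metis
  then have ge: "g (m (Some a)) = a" if "a \<in> A" for a
    using that inv_into_f_f[OF e_inj that] by (auto simp: e_def)
  have mV: "m u \<in> V" if "u \<in> ?X" for u
    using m \<open>B \<subseteq> V\<close> that by (auto simp: bij_betw_def)
  define x where "x = g (m None)"
  have xV: "x \<in> V" using mV g by (simp add: x_def Aut_mem_iff)
  have xa: "E x a \<longleftrightarrow> F None (Some a)" "E a x \<longleftrightarrow> F (Some a) None" if "a \<in> A" for a
    using Aut_edge_iff[OF g(1) mV mV, of None "Some a"] Aut_edge_iff[OF g(1) mV mV, of "Some a" None]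
      mE ge that by (auto simp: x_def)
  have "x \<notin> A"
  proof
    assume "x \<in> A"
    moreover have "inj g" using g(1) by (auto simp: Aut_def permutes_inj)
    ultimately have "m None = m (Some x)" using ge x_def by (metis injD)
    then show False using m \<open>x \<in> A\<close> by (auto simp: bij_betw_def inj_on_def)
  qed
  show thesis
  proof (rule that[of x])
    show "x \<in> V - A" using xV \<open>x \<notin> A\<close> by simp
    show "(x, a) \<in> perp V E \<longleftrightarrow> a \<in> D" if "a \<in> A" for a
      using that xa xV A by (auto simp: perp_iff F_def)
    show "E x a \<longleftrightarrow> a \<in> N" if "a \<in> A - D" for a
      using that xa by (auto simp: F_def)
  qed
qed

text \<open>\<open>X\<close> lies inside one part, so it can serve as \<open>C\<close>;
  \<open>D\<close> empty keeps the new vertex out of that part.\<close>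

lemma extension_new_part:
  assumes "X \<subseteq> V" "finite X" "\<And>u v. u \<in> X \<Longrightarrow> v \<in> X \<Longrightarrow> (u, v) \<in> perp V E"
  obtains r where "r \<in> V" "\<And>x. x \<in> X \<Longrightarrow> (r, x) \<notin> perp V E" "\<And>x. x \<in> X \<Longrightarrow> E r x \<longleftrightarrow> x \<in> N"
  by (rule extension[of X X "{}" N]) (use assms in auto)

text \<open>\<open>T\<close> has at most one vertex in each part and none in that of
  \<open>p\<close>, so parity leaves the edges to \<open>T\<close> free. With \<open>T\<close> empty
  this says that parts are infinite.\<close>

lemma extension_same_part:
  assumes "p \<in> V" "finite F" "finite T" "T \<subseteq> V"
    and T: "\<And>t. t \<in> T \<Longrightarrow> (p, t) \<notin> perp V E"
      "\<And>t t'. t \<in> T \<Longrightarrow> t' \<in> T \<Longrightarrow> (t, t') \<in> perp V E \<Longrightarrow> t = t'"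
  obtains v where "(p, v) \<in> perp V E" "v \<notin> F" "\<forall>t\<in>T. E v t \<longleftrightarrow> t \<in> N"
proof -
  \<comment> \<open>The new vertex avoids \<open>C\<close> by being new, and the rest of
    \<open>F\<close> by lying in the part of \<open>p\<close>.\<close>
  define C where "C = insert p {f \<in> F. (p, f) \<in> perp V E}"
  have C: "(p, c) \<in> perp V E" if "c \<in> C" for c
    using that assms(1) by (auto simp: C_def perp_refl)
  have CC: "(c, c') \<in> perp V E" if "c \<in> C" "c' \<in> C" for c c'
    using C that perp_sym perp_trans by blast
  have CT: "(c, t) \<notin> perp V E" "(t, c) \<notin> perp V E" if "c \<in> C" "t \<in> T" for c t
    using C that T perp_sym perp_trans by blast+
  have "(u, v) \<in> perp V E \<longleftrightarrow> u = v \<or> u \<in> C \<and> v \<in> C" if "u \<in> C \<union> T" "v \<in> C \<union> T" for u v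
    using that CC CT T(2) perp_refl assms(4) by blast
  moreover have "C \<union> T \<subseteq> V" "finite (C \<union> T)"
    using C assms by (auto simp: perp_iff C_def)
  ultimately obtain x where x: "x \<in> V - (C \<union> T)"
    "\<And>a. a \<in> C \<union> T \<Longrightarrow> (x, a) \<in> perp V E \<longleftrightarrow> a \<in> C"
    "\<And>a. a \<in> C \<union> T - C \<Longrightarrow> E x a \<longleftrightarrow> a \<in> N"
    using extension[of "C \<union> T" C C N] by blast
  have px: "(p, x) \<in> perp V E" using x(2)[of p] by (auto simp: C_def intro: perp_sym)
  show thesis
  proof (rule that[OF px])
    show "x \<notin> F" using x(1) px by (auto simp: C_def)
    show "\<forall>t\<in>T. E x t \<longleftrightarrow> t \<in> N"
      using x(3) CT CC by blast
  qed
qed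

section \<open>Automorphisms and their supports\<close>

lemma Aut_eq_id_if_preserves_parts:
  assumes g: "g \<in> Aut V E" and pres: "\<And>v. v \<in> V \<Longrightarrow> (v, g v) \<in> perp V E"
  shows "g = id"
proof (rule ccontr)
  assume "g \<noteq> id"
  then obtain q where q: "g q \<noteq> q" by (auto simp: fun_eq_iff)
  have perm: "g permutes V" using g by (simp add: Aut_def)
  then have "q \<in> V" using q by (meson permutes_not_in)
  \<comment> \<open>Avoiding \<open>inv g q\<close> ensures \<open>g s \<noteq> q\<close>.\<close>
  obtain s where s: "(q, s) \<in> perp V E" "s \<notin> {q, g q, inv g q}"
    using extension_same_part[of q "{q, g q, inv g q}" "{}"] \<open>q \<in> V\<close> by auto
  have "s \<in> V" using s by (simp add: perp_iff)
  have gs: "g s \<noteq> q" using s perm by (auto simp: permutes_inverses)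
  let ?X = "{q, s, g q, g s}"
  have X: "(q, x) \<in> perp V E" if "x \<in> ?X" for x
    using that s(1) pres \<open>q \<in> V\<close> \<open>s \<in> V\<close> perp_refl perp_trans by blast
  have "(x, y) \<in> perp V E" if "x \<in> ?X" "y \<in> ?X" for x y
    using X[OF that(1)] X[OF that(2)] perp_sym perp_trans by blast
  moreover have "?X \<subseteq> V" using X by (auto simp: perp_iff)
  ultimately obtain r where r: "r \<in> V" "\<And>x. x \<in> ?X \<Longrightarrow> (r, x) \<notin> perp V E"
    "\<And>x. x \<in> ?X \<Longrightarrow> E r x \<longleftrightarrow> x \<in> {q}"
    using extension_new_part[of ?X "{q}"] by (metis finite.emptyI finite.insertI)
  have "(g q, g s) \<in> perp V E" using s(1) g by (simp add: Aut_perp_iff)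
  then have "(E r (g q) \<longleftrightarrow> E r (g s)) \<longleftrightarrow> (E (g r) (g q) \<longleftrightarrow> E (g r) (g s))"
    using pres r by (intro parity) auto
  also have "\<dots> \<longleftrightarrow> (E r q \<longleftrightarrow> E r s)"
    using g r(1) \<open>q \<in> V\<close> \<open>s \<in> V\<close> by (simp add: Aut_edge_iff)
  \<comment> \<open>The left side is true: \<open>r\<close> has an edge to neither
    \<open>g q\<close> nor \<open>g s\<close>. The right side is false: it has one to
    \<open>q\<close> but none to \<open>s\<close>.\<close>
  finally show False using r(3) q s(2) gs by auto
qed

end

theorem lemma7p13:
  fixes V :: "'a set" and E :: "'a \<Rightarrow> 'a \<Rightarrow> bool" and g :: "'a \<Rightarrow> 'a"
  assumes "semigeneric_tournament V E"
    and "g \<in> Aut V E - {id}"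
    and "P \<in> parts V E"
  shows "infinite (supp V g \<inter> P)"
proof
  assume fin: "finite (supp V g \<inter> P)"
  interpret semigeneric V E using assms(1) by unfold_locales
  have g: "g \<in> Aut V E" using assms(2) by simp
  obtain p where p: "p \<in> V" "P = perp V E `` {p}"
    using assms(3) by (auto simp: parts_def elim: quotientE)
  have fixed: "g v = v" if "(p, v) \<in> perp V E" "v \<notin> supp V g \<inter> P" for v
    using that p by (auto simp: supp_def perp_iff)
  \<comment> \<open>\<open>P\<close> is infinite and its moved vertices are finitely many, so some
    \<open>f\<close> in \<open>P\<close> is fixed; hence \<open>g\<close> preserves
    \<open>P\<close>.\<close>
  obtain f where f: "(p, f) \<in> perp V E" "g f = f"
    using extension_same_part[of p "supp V g \<inter> P" "{}"] p fin fixed by auto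
  have gP: "(p, g q) \<in> perp V E \<longleftrightarrow> (p, q) \<in> perp V E" for q
    using f Aut_perp_iff[OF g, of f q] perp_sym perp_trans by metis
  have "(q, g q) \<in> perp V E" if "q \<in> V" for q
  proof (rule ccontr)
    assume nperp: "(q, g q) \<notin> perp V E"
    \<comment> \<open>If \<open>q\<close> or \<open>g q\<close> were in \<open>P\<close>,
      \<open>gP\<close> would put both there, against \<open>nperp\<close>.\<close>
    then have q: "(p, q) \<notin> perp V E" "(p, g q) \<notin> perp V E"
      using gP perp_sym perp_trans by blast+
    have gq: "g q \<in> V" "g q \<noteq> q"
      using that g nperp perp_refl by (auto simp: Aut_mem_iff)
    have T': "finite {q, g q}" "{q, g q} \<subseteq> V"
      using gq that by simp_all
    have T: "t \<in> {q, g q} \<Longrightarrow> (p, t) \<notin> perp V E"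
      "t \<in> {q, g q} \<Longrightarrow> t' \<in> {q, g q} \<Longrightarrow> (t, t') \<in> perp V E \<Longrightarrow> t = t'" for t t'
      using q nperp perp_sym by blast+
    \<comment> \<open>Avoiding the moved vertices of \<open>P\<close> makes \<open>v\<close> fixed,
      so \<open>g\<close> sends the edge from \<open>v\<close> to \<open>q\<close> to one from
      \<open>v\<close> to \<open>g q\<close>, which \<open>N = {q}\<close> excludes.\<close>
    obtain v where v: "(p, v) \<in> perp V E" "v \<notin> supp V g \<inter> P"
      "\<forall>t\<in>{q, g q}. E v t \<longleftrightarrow> t \<in> {q}"
      by (rule extension_same_part[OF p(1) fin T'(1,2) T, where N = "{q}"]) blast
    have "E (g v) (g q) \<longleftrightarrow> E v q"
      using v(1) that g by (auto simp: Aut_edge_iff perp_iff)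
    then show False using fixed[OF v(1,2)] v(3) gq by auto
  qed
  then show False using Aut_eq_id_if_preserves_parts[OF g] assms(2) by simp
qed

end
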